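(* Let $(\mathfrak g,[\cdot,\cdot],\alpha)$ be a Hom-Lie algebra over $\mathbb K$ and let $\mathrm{ad}:\mathfrak g\to\mathrm{End}(\mathfrak g)$ be defined for $x\in\mathfrak g$ by $\mathrm{ad}(x)(y)=[x,y]$. Then $(\mathfrak g,\mathrm{ad},\alpha)$ is a representation of $\mathfrak g$.
   Context: $\mathbb K$ is an algebraically closed field of characteristic $0$. A Hom-Lie algebra is a triple $(\mathfrak g,[\cdot,\cdot],\alpha)$ with $[\cdot,\cdot]$ a skew-symmetric bilinear bracket and $\alpha$ a linear map such that $[\alpha(x),[y,z]]+[\alpha(y),[z,x]]+[\alpha(z),[x,y]]=0$ for all $x,y,z$. A representation of it is a triple $(V,\rho,\beta)$ with $V$ a $\mathbb K$-vector space, $\beta\in\mathrm{End}(V)$ and $\rho:\mathfrak g\to\mathrm{End}(V)$ linear with $\rho([x,y])\circ\beta=\rho(\alpha(x))\circ\rho(y)-\rho(\alpha(y))\circ\rho(x)$ for all $x,y\in\mathfrak g$. *)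

theory Defs
  imports "HOL-Computational_Algebra.Polynomial"
begin

(* The twisting map alpha is only required to be linear, not multiplicative. *)
locale hom_lie_algebra = vector_space scale
  for scale :: "'k::field \<Rightarrow> 'g::ab_group_add \<Rightarrow> 'g" +
  fixes bracket :: "'g \<Rightarrow> 'g \<Rightarrow> 'g"
    and \<alpha> :: "'g \<Rightarrow> 'g"
  assumes linear_bracket_left: "Vector_Spaces.linear scale scale (\<lambda>x. bracket x y)"
    and linear_bracket_right: "Vector_Spaces.linear scale scale (\<lambda>y. bracket x y)"
    and skew_symmetric: "bracket x y = - bracket y x"
    and linear_twist: "Vector_Spaces.linear scale scale \<alpha>"
    and hom_jacobi:
      "bracket (\<alpha> x) (bracket y z) + bracket (\<alpha> y) (bracket z x)
        + bracket (\<alpha> z) (bracket x y) = 0"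

(* A linear map from g to End(V) is a map rho into functions on V such that each rho x is
   linear (rho_endomorphism) and rho is linear for the pointwise operations on End(V)
   (linear_rho). *)
locale hom_lie_representation =
  hom_lie_algebra scale bracket \<alpha> + V: vector_space scaleV
  for scale :: "'k::field \<Rightarrow> 'g::ab_group_add \<Rightarrow> 'g"
    and bracket :: "'g \<Rightarrow> 'g \<Rightarrow> 'g"
    and \<alpha> :: "'g \<Rightarrow> 'g"
    and scaleV :: "'k \<Rightarrow> 'v::ab_group_add \<Rightarrow> 'v" +
  fixes \<rho> :: "'g \<Rightarrow> 'v \<Rightarrow> 'v"
    and \<beta> :: "'v \<Rightarrow> 'v"
  assumes linear_beta: "Vector_Spaces.linear scaleV scaleV \<beta>"
    and rho_endomorphism: "Vector_Spaces.linear scaleV scaleV (\<rho> x)"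
    and linear_rho: "Vector_Spaces.linear scale scaleV (\<lambda>x. \<rho> x v)"
    and rho_bracket:
      "\<rho> (bracket x y) \<circ> \<beta> = (\<lambda>v. (\<rho> (\<alpha> x) \<circ> \<rho> y) v - (\<rho> (\<alpha> y) \<circ> \<rho> x) v)"

definition ad :: "('g \<Rightarrow> 'g \<Rightarrow> 'g) \<Rightarrow> 'g \<Rightarrow> 'g \<Rightarrow> 'g" where
  "ad bracket x = (\<lambda>y. bracket x y)"

end

theory Submission
  imports Defs
begin

text \<open>Evaluated at z, the compatibility condition for \<open>ad\<close> with \<beta> =
  \<alpha> reads [[x,y], \<alpha> z] = [\<alpha> x, [y,z]] - [\<alpha> y, [x,z]]. This is the
  Hom-Jacobi identity rearranged by skew-symmetry (\<open>bracket_bracket_twist\<close>); taking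
  \<beta> = \<alpha> is what puts the twist on z. The remaining conditions are the bilinearity of
  the bracket and the linearity of \<alpha>.\<close>

context hom_lie_algebra
begin

lemma bracket_minus_right: "bracket x (- y) = - bracket x y"
  using linear_bracket_right[of x] by (simp add: module_hom.neg flip: module_hom_iff_linear)

text \<open>Hom-Jacobi solved for its cyclic term with \<alpha> z outside. Two flips by
  skew-symmetry, one of an outer and one of an inner bracket, give the form that
  \<open>rho_bracket\<close> demands.\<close>

lemma bracket_bracket_twist:
  "bracket (bracket x y) (\<alpha> z)
    = bracket (\<alpha> x) (bracket y z) - bracket (\<alpha> y) (bracket x z)"
proof -
  have "bracket (bracket x y) (\<alpha> z) = - bracket (\<alpha> z) (bracket x y)"
    by (rule skew_symmetric)
  also have "\<dots> = bracket (\<alpha> x) (bracket y z) + bracket (\<alpha> y) (bracket z x)"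
    using hom_jacobi[of x y z] by (metis minus_unique add.commute)
  also have "bracket (\<alpha> y) (bracket z x) = - bracket (\<alpha> y) (bracket x z)"
    using skew_symmetric[of z x] by (simp add: bracket_minus_right)
  finally show ?thesis
    by simp
qed

end

theorem proposition2p4:
  fixes scale :: "'k::{alg_closed_field, field_char_0} \<Rightarrow> 'g::ab_group_add \<Rightarrow> 'g"
    and bracket :: "'g \<Rightarrow> 'g \<Rightarrow> 'g"
    and \<alpha> :: "'g \<Rightarrow> 'g"
  assumes "hom_lie_algebra scale bracket \<alpha>"
  shows "hom_lie_representation scale bracket \<alpha> scale (ad bracket) \<alpha>"
proof -
  interpret hom_lie_algebra scale bracket \<alpha>
    by (fact assms)
  show ?thesis
  proof (intro hom_lie_representation.intro hom_lie_representation_axioms.intro)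
    show "hom_lie_algebra scale bracket \<alpha>"
      by (fact assms)
    show "vector_space scale"
      by (fact vector_space_axioms)
    show "Vector_Spaces.linear scale scale \<alpha>"
      by (fact linear_twist)
    show "Vector_Spaces.linear scale scale (ad bracket x)" for x
      unfolding ad_def by (fact linear_bracket_right)
    show "Vector_Spaces.linear scale scale (\<lambda>x. ad bracket x v)" for v
      unfolding ad_def by (fact linear_bracket_left)
    \<comment> \<open>Equality of endomorphisms is checked at each v, where it becomes
      \<open>bracket_bracket_twist\<close> with z = v.\<close>
    show "ad bracket (bracket x y) \<circ> \<alpha>
        = (\<lambda>v. (ad bracket (\<alpha> x) \<circ> ad bracket y) v - (ad bracket (\<alpha> y) \<circ> ad bracket x) v)"
      for x y
      by (simp add: fun_eq_iff ad_def bracket_bracket_twist)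
  qed
qed

end
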